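(* Let $\mathbb{F}_q$ be a finite field with $q\equiv 1\pmod{9}$, let $s=(q-1)/3$, let $\mu_3=\{u\in\mathbb{F}_q^*: u^3=1\}$, let $k$ be a positive integer and $r=1+ks$. Let $c\colon\mu_3\to\mathbb{F}_q^*$ be a function with $c(u)^s=1$ for all $u\in\mu_3$. Define $f\colon\mathbb{F}_q\to\mathbb{F}_q$ by $f(0)=0$ and $f(x)=x^r\,c(x^s)$ for $x\in\mathbb{F}_q^*$, and let $F(x)=f(x)+x$. For each $u\in\mu_3$ set $\tau(u)=1+c(u)\,u^k$ and $v(u)=\tau(u)^s$. Assume: (H1) $\tau(u)\neq 0$ for all $u\in\mu_3$; (H2) the map $\bar\psi\colon\mu_3\to\mu_3$, $\bar\psi(u)=u\cdot v(u)$, is a permutation of $\mu_3$. Then $f$ is a complete permutation polynomial of $\mathbb{F}_q$, i.e., both $f$ and $F$ are bijections of $\mathbb{F}_q$.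
   Context: A complete permutation polynomial of $\mathbb{F}_q$ is a polynomial (equivalently, a function $\mathbb{F}_q\to\mathbb{F}_q$) $f$ such that both $x\mapsto f(x)$ and $x\mapsto f(x)+x$ are permutations of $\mathbb{F}_q$. For $x\in\mathbb{F}_q^*$ one has $x^s\in\mu_3$, so $c(x^s)$ is defined; $f$ agrees on $\mathbb{F}_q$ with a polynomial $X^r h(X^s)$ where $h$ interpolates $c$ on $\mu_3$. *)

theory Defs
  imports
    Complex_Main
    "HOL-Computational_Algebra.Primes"
    "HOL-Number_Theory.Cong"
    "HOL-Library.Cardinality"
begin

(* Stated for functions: over a finite field every function is induced by a polynomial. *)
definition complete_permutation_polynomial :: "('a::finite_field \<Rightarrow> 'a) \<Rightarrow> bool" where
  "complete_permutation_polynomial f \<longleftrightarrow> bij f \<and> bij (\<lambda>x. f x + x)"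

definition mu3 :: "'a::finite_field set" where
  "mu3 = {u. u \<noteq> 0 \<and> u ^ 3 = 1}"

end

theory Submission
  imports Defs
begin

text \<open>On nonzero \<open>x\<close>, both \<open>f\<close> and \<open>x \<mapsto> f x + x\<close> have the shape \<open>x * d (x ^ s)\<close>, and the \<open>s\<close>-th power
  of such a value is \<open>u * d u ^ s\<close> with \<open>u = x ^ s\<close>. If \<open>u \<mapsto> u * d u ^ s\<close> is injective on the cube roots
  of unity, the value determines \<open>u\<close> and hence \<open>x\<close>. For \<open>f\<close> that induced map is the identity,
  because \<open>q \<equiv> 1\<close> modulo 9 makes \<open>s\<close> divisible by 3.\<close>

lemma finite_field_power_card_minus_1:
  fixes x :: "'a::finite_field"
  assumes "x \<noteq> 0"
  shows "x ^ (CARD('a) - 1) = 1"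
proof -
  have "x ^ (CARD('a) - 1) * x = x"
    using finite_field_power_card_eq_same[of x] by (simp flip: power_Suc2)
  then show ?thesis
    using assms by simp
qed

text \<open>Stated for a general factor \<open>d\<close> because it is applied twice: to
  \<open>f\<close> with \<open>c u * u ^ k\<close>, and to \<open>f x + x\<close> with that factor
  plus one.\<close>

lemma bij_mult_of_power:
  fixes g d :: "'a::finite_field \<Rightarrow> 'a"
  assumes s: "3 * s = CARD('a) - 1"
    and g_zero: "g 0 = 0"
    and g_nonzero: "\<And>x. x \<noteq> 0 \<Longrightarrow> g x = x * d (x ^ s)"
    and d_nonzero: "\<And>u. u \<in> mu3 \<Longrightarrow> d u \<noteq> 0"
    and inj: "inj_on (\<lambda>u. u * d u ^ s) mu3"
  shows "bij g"
proof -
  have mu3: "x ^ s \<in> mu3" if "x \<noteq> 0" for x :: 'a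
    using finite_field_power_card_minus_1[OF that] that s
    by (simp add: mu3_def mult.commute flip: power_mult)
  have g_zero_iff: "g x = 0 \<longleftrightarrow> x = 0" for x
    using g_zero g_nonzero d_nonzero mu3 by (cases "x = 0") auto
  have "inj g"
  proof (rule injI)
    fix x y assume eq: "g x = g y"
    show "x = y"
    proof (cases "x = 0")
      case True
      then show ?thesis
        using eq g_zero g_zero_iff by metis
    next
      case False
      then have y: "y \<noteq> 0"
        using eq g_zero_iff by metis
      \<comment> \<open>Raising \<open>g x = g y\<close> to the power \<open>s\<close> gives an
        equation between two values of the map that is injective on \<open>mu3\<close>.\<close>
      have "x ^ s * d (x ^ s) ^ s = y ^ s * d (y ^ s) ^ s"
        using eq g_nonzero[OF False] g_nonzero[OF y] by (metis power_mult_distrib)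
      then have "x ^ s = y ^ s"
        using inj mu3[OF False] mu3[OF y] by (auto dest: inj_onD)
      \<comment> \<open>Now the two factors \<open>d\<close> agree and, being nonzero,
        cancel.\<close>
      then show ?thesis
        using eq g_nonzero[OF False] g_nonzero[OF y] d_nonzero[OF mu3[OF y]] by simp
    qed
  qed
  then show ?thesis
    by (simp add: bij_def finite_UNIV_inj_surj)
qed

theorem theorem5p1:
  fixes q s k r :: nat
    and c f \<tau> v :: "'a::finite_field \<Rightarrow> 'a"
  assumes q_def: "q = CARD('a)"
    and q_cong: "[q = 1] (mod 9)"
    and s_def: "s = (q - 1) div 3"
    and k_pos: "k > 0"
    and r_def: "r = 1 + k * s"
    and c_nz: "\<And>u. u \<in> mu3 \<Longrightarrow> c u \<noteq> 0"
    and c_pow: "\<And>u. u \<in> mu3 \<Longrightarrow> c u ^ s = 1"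
    and f_zero: "f 0 = 0"
    and f_nonzero: "\<And>x. x \<noteq> 0 \<Longrightarrow> f x = x ^ r * c (x ^ s)"
    and tau_def: "\<And>u. u \<in> mu3 \<Longrightarrow> \<tau> u = 1 + c u * u ^ k"
    and v_def: "\<And>u. u \<in> mu3 \<Longrightarrow> v u = \<tau> u ^ s"
    and H1: "\<And>u. u \<in> mu3 \<Longrightarrow> \<tau> u \<noteq> 0"
    and H2: "bij_betw (\<lambda>u. u * v u) mu3 mu3"
  shows "complete_permutation_polynomial f"
proof -
  \<comment> \<open>Ensures \<open>1 \<le> q\<close>, so that the subtraction on naturals is not
    truncated when the congruence is read as divisibility.\<close>
  have "CARD('a) - 1 > 0"
    using card_mono[of UNIV "{0, 1 :: 'a}"] by simp
  then have "9 dvd q - 1"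
    using q_cong q_def by (simp add: cong_altdef_nat cong_sym_eq)
  then obtain m where m: "q - 1 = 9 * m"
    by (rule dvdE)
  \<comment> \<open>One factor 3 of \<open>9 * m\<close> makes the division defining
    \<open>s\<close> exact; the other stays in \<open>s\<close> and kills cube roots of
    unity.\<close>
  then have s: "s = 3 * m" and card: "3 * s = CARD('a) - 1"
    using s_def q_def by simp_all
  let ?d = "\<lambda>u. c u * u ^ k"
  \<comment> \<open>Since \<open>r = 1 + k * s\<close>, the power \<open>x ^ r\<close> splits as
    \<open>x * (x ^ s) ^ k\<close>.\<close>
  have f_eq: "f x = x * ?d (x ^ s)" if "x \<noteq> 0" for x
    using f_nonzero[OF that] r_def by (simp add: mult_ac flip: power_mult)
  have "?d u ^ s = 1" if "u \<in> mu3" for u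
  proof -
    have "?d u ^ s = c u ^ s * (u ^ 3) ^ (m * k)"
      by (simp add: s power_mult_distrib mult_ac flip: power_mult)
    then show ?thesis
      using that c_pow by (simp add: mu3_def)
  qed
  then have "inj_on (\<lambda>u. u * ?d u ^ s) mu3"
    by (auto simp: inj_on_def)
  then have "bij f"
    using f_zero f_eq c_nz by (intro bij_mult_of_power[OF card, of f ?d]) (auto simp: mu3_def)
  moreover have "bij (\<lambda>x. f x + x)"
  proof (rule bij_mult_of_power[OF card, where d = "\<lambda>u. 1 + ?d u"])
    \<comment> \<open>On \<open>mu3\<close> this map is the permutation in \<open>H2\<close>, as
      \<open>1 + ?d u\<close> is \<open>\<tau> u\<close> there.\<close>
    show "inj_on (\<lambda>u. u * (1 + ?d u) ^ s) mu3"
      using bij_betw_imp_inj_on[OF H2] by (rule inj_on_cong[THEN iffD1, rotated])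
        (simp add: v_def tau_def)
  qed (use f_zero f_eq H1 tau_def in \<open>auto simp: algebra_simps\<close>)
  ultimately show ?thesis
    by (simp add: complete_permutation_polynomial_def)
qed

end
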